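(* Let $\mu$ be a positive rational number, let $A\in\mathcal{M}_\mu^i$ be irreducible, and for $j=1,2,\dots$ let $A_j=A\otimes I_j$, so that $\langle A\rangle=\{A_1,A_2,\dots\}$. Then the mapping $\varphi$ from $\langle A\rangle$ to the collection $\{\mathcal{M}_\mu^k: k=1,2,\dots\}$ defined by $\varphi(A_j):=\mathcal{M}_\mu^{ij}$, $j=1,2,\dots$, is a lattice homomorphism from $(\langle A\rangle,\prec)$ to $(\{\mathcal{M}_\mu^k\}_{k\ge 1},\sqsubset)$.
   Context: Matrices are over a field $\mathbb{F}$ of characteristic $0$; $\otimes$ is the Kronecker product. Write $\mu=\mu_y/\mu_x$ with $\mu_y,\mu_x$ coprime positive integers and $\mathcal{M}_\mu^k:=\mathcal{M}_{k\mu_y\times k\mu_x}$. $A\sim B$ means $A\otimes I_s=B\otimes I_t$ for some positive integers $s,t$; $\langle A\rangle$ is the $\sim$-class of $A$. A matrix is irreducible if it is not of the form $B\otimes I_s$ with $s\ge2$. On $\langle A\rangle$, $B\prec C$ means $C=B\otimes I_s$ for some positive integer $s$; $(\langle A\rangle,\prec)$ is a lattice. On $\{\mathcal{M}_\mu^k\}$, $\mathcal{M}_\mu^\alpha\sqsubset\mathcal{M}_\mu^\beta$ iff $\alpha\mid\beta$ (in which case $\mathcal{M}_\mu^\alpha$ is regarded as a subspace of $\mathcal{M}_\mu^\beta$ via $X\mapsto X\otimes I_{\beta/\alpha}$); this is a lattice with sup given by $\mathrm{lcm}$ and inf by $\gcd$ of superscripts. A lattice homomorphism is a map $\varphi$ with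 $\varphi(\sup(a,b))=\sup(\varphi(a),\varphi(b))$ and $\varphi(\inf(a,b))=\inf(\varphi(a),\varphi(b))$ for all $a,b$. *)

theory Defs
  imports "Jordan_Normal_Form.Matrix" "HOL-Algebra.Lattice" "HOL-Library.FuncSet"
begin

definition kronecker :: "'a::semiring_1 mat \<Rightarrow> 'a mat \<Rightarrow> 'a mat" (infixl "\<otimes>\<^sub>K" 70) where
  "A \<otimes>\<^sub>K B = mat (dim_row A * dim_row B) (dim_col A * dim_col B)
     (\<lambda>(i, j). A $$ (i div dim_row B, j div dim_col B) * B $$ (i mod dim_row B, j mod dim_col B))"

definition mat_equiv :: "'a::semiring_1 mat \<Rightarrow> 'a mat \<Rightarrow> bool" where
  "mat_equiv A B \<longleftrightarrow> (\<exists>s t. s > 0 \<and> t > 0 \<and> A \<otimes>\<^sub>K 1\<^sub>m s = B \<otimes>\<^sub>K 1\<^sub>m t)"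

definition mat_class :: "'a::semiring_1 mat \<Rightarrow> 'a mat set" where
  "mat_class A = {B. mat_equiv A B}"

definition irreducible_mat :: "'a::semiring_1 mat \<Rightarrow> bool" where
  "irreducible_mat A \<longleftrightarrow> \<not> (\<exists>B s. s \<ge> 2 \<and> A = B \<otimes>\<^sub>K 1\<^sub>m s)"

definition mat_prec :: "'a::semiring_1 mat \<Rightarrow> 'a mat \<Rightarrow> bool" where
  "mat_prec B C \<longleftrightarrow> (\<exists>s. s > 0 \<and> C = B \<otimes>\<^sub>K 1\<^sub>m s)"

definition class_lattice :: "'a::semiring_1 mat \<Rightarrow> 'a mat gorder" where
  "class_lattice A = \<lparr>carrier = mat_class A, eq = (=), le = mat_prec\<rparr>"

text \<open>For \<open>\<mu> > 0\<close>, \<^const>\<open>quotient_of\<close> yields the representation \<open>\<mu> = \<mu>\<^sub>y / \<mu>\<^sub>x\<close> by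
  coprime positive integers.\<close>

definition mat_space :: "rat \<Rightarrow> nat \<Rightarrow> 'a mat set" where
  "mat_space \<mu> k =
     (let (\<mu>\<^sub>y, \<mu>\<^sub>x) = quotient_of \<mu> in carrier_mat (k * nat \<mu>\<^sub>y) (k * nat \<mu>\<^sub>x))"

text \<open>For \<open>\<mu> > 0\<close> the exponent of a space is determined by the space (through the number of rows),
  so the following order on sets of matrices is exactly divisibility of exponents.\<close>

definition space_le :: "rat \<Rightarrow> 'a mat set \<Rightarrow> 'a mat set \<Rightarrow> bool" where
  "space_le \<mu> U V \<longleftrightarrow>
     (\<exists>\<alpha> \<beta>. \<alpha> > 0 \<and> \<beta> > 0 \<and> U = mat_space \<mu> \<alpha> \<and> V = mat_space \<mu> \<beta> \<and> \<alpha> dvd \<beta>)"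

definition space_lattice :: "rat \<Rightarrow> 'a mat set gorder" where
  "space_lattice \<mu> = \<lparr>carrier = {mat_space \<mu> k | k. k > 0}, eq = (=), le = space_le \<mu>\<rparr>"

text \<open>\<^const>\<open>join_pres\<close> and \<^const>\<open>meet_pres\<close> include that \<open>X\<close> and \<open>Y\<close> are lattices.\<close>

definition lattice_homomorphism ::
    "('a, 'c) gorder_scheme \<Rightarrow> ('b, 'd) gorder_scheme \<Rightarrow> ('a \<Rightarrow> 'b) \<Rightarrow> bool" where
  "lattice_homomorphism X Y f \<longleftrightarrow>
     f \<in> carrier X \<rightarrow> carrier Y \<and> join_pres X Y f \<and> meet_pres X Y f"

end

theory Submission
  imports Defs "HOL-Number_Theory.Cong"
begin

text \<open>Suppose \<open>A \<otimes>\<^sub>K I\<^sub>s = B \<otimes>\<^sub>K I\<^sub>t\<close>. After cancelling \<open>gcd s t\<close> we may take \<open>s\<close> and \<open>t\<close> coprime, and then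
  \<open>A = C \<otimes>\<^sub>K I\<^sub>t\<close> for some \<open>C\<close>: moving one step down the diagonal of the common product leaves
  a block of \<open>A\<close> and a block of \<open>B\<close> simultaneously only at multiples of \<open>s t\<close>. If \<open>A\<close> is irreducible
  this forces \<open>t = 1\<close>, so \<open>B = A \<otimes>\<^sub>K I\<^sub>s\<close>. Hence the class of \<open>A\<close>, like the family of spaces,
  is a copy of the positive integers under divisibility, and \<open>j \<mapsto> i * j\<close> preserves \<open>lcm\<close> and \<open>gcd\<close>.\<close>

section \<open>Kronecker products with identity matrices\<close>

lemma dim_kronecker_one [simp]:
  "dim_row (A \<otimes>\<^sub>K 1\<^sub>m s) = dim_row A * s" "dim_col (A \<otimes>\<^sub>K 1\<^sub>m s) = dim_col A * s"
  by (simp_all add: kronecker_def)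

lemma index_kronecker_one:
  assumes "p < dim_row A * s" "q < dim_col A * s"
  shows "(A \<otimes>\<^sub>K 1\<^sub>m s) $$ (p, q) = (if p mod s = q mod s then A $$ (p div s, q div s) else 0)"
proof -
  have "s > 0" using assms(1) by (cases s) auto
  then show ?thesis using assms by (simp add: kronecker_def)
qed

lemma kronecker_one_1 [simp]: "A \<otimes>\<^sub>K 1\<^sub>m 1 = A" "A \<otimes>\<^sub>K 1\<^sub>m (Suc 0) = A"
  by (rule eq_matI; simp add: index_kronecker_one)+

lemma kronecker_one_one: "A \<otimes>\<^sub>K 1\<^sub>m s \<otimes>\<^sub>K 1\<^sub>m t = A \<otimes>\<^sub>K 1\<^sub>m (s * t)"
proof (rule eq_matI)
  fix p q assume pq: "p < dim_row (A \<otimes>\<^sub>K 1\<^sub>m (s * t))" "q < dim_col (A \<otimes>\<^sub>K 1\<^sub>m (s * t))"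
  then have pq': "p < dim_row A * s * t" "q < dim_col A * s * t" by (simp_all add: mult.assoc)
  then have t: "t > 0" by (cases t) auto
  \<comment> \<open>A residue modulo \<open>s * t\<close> consists of a residue modulo
    \<open>t\<close> and the residue of the quotient modulo \<open>s\<close>. The two conjuncts are
    the nonvanishing conditions of the outer and the inner identity factor.\<close>
  have mod_iff: "p mod (s * t) = q mod (s * t) \<longleftrightarrow>
      p mod t = q mod t \<and> p div t mod s = q div t mod s"
    (is "?l = ?r")
  proof
    assume ?l
    then have "p mod (t * s) mod t = q mod (t * s) mod t"
      "p mod (t * s) div t = q mod (t * s) div t" by (simp_all add: mult.commute)
    then show ?r using t by (simp add: mod_mult2_eq)
  next
    assume ?r
    then show ?l using mod_mult2_eq[of p t s] mod_mult2_eq[of q t s] by (simp add: mult.commute)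
  qed
  have "p div t < dim_row A * s" "q div t < dim_col A * s"
    using pq' by (simp_all add: less_mult_imp_div_less)
  moreover have "p div (s * t) = p div t div s" "q div (s * t) = q div t div s"
    using div_mult2_eq[of p t s] div_mult2_eq[of q t s] by (simp_all add: mult.commute)
  ultimately show "(A \<otimes>\<^sub>K 1\<^sub>m s \<otimes>\<^sub>K 1\<^sub>m t) $$ (p, q) = (A \<otimes>\<^sub>K 1\<^sub>m (s * t)) $$ (p, q)"
    using pq pq' mod_iff by (simp add: index_kronecker_one mult.assoc)
qed (simp_all add: mult.assoc)

lemma kronecker_one_cancel:
  assumes "A \<otimes>\<^sub>K 1\<^sub>m s = B \<otimes>\<^sub>K 1\<^sub>m s" "s > 0"
  shows "A = B"
proof (rule eq_matI)
  show r: "dim_row A = dim_row B" and c: "dim_col A = dim_col B"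
    using assms dim_kronecker_one[of A s] dim_kronecker_one[of B s] by auto
  fix p q assume pq: "p < dim_row B" "q < dim_col B"
  \<comment> \<open>The entry at \<open>(p, q)\<close> is read off from the top left corner of its
    \<open>s\<close> by \<open>s\<close> block in the product.\<close>
  then have "p * s < dim_row B * s" "q * s < dim_col B * s" using assms(2) by auto
  then show "A $$ (p, q) = B $$ (p, q)"
    using index_kronecker_one[of "p * s" A s "q * s"] index_kronecker_one[of "p * s" B s "q * s"]
      assms r c by simp
qed

lemma kronecker_one_inject:
  assumes "dim_row A > 0"
  shows "A \<otimes>\<^sub>K 1\<^sub>m j = A \<otimes>\<^sub>K 1\<^sub>m k \<longleftrightarrow> j = k"
  using assms by (metis dim_kronecker_one(1) mult_cancel1 less_irrefl)

text \<open>Passing from \<open>k\<close> to \<open>Suc k\<close> changes \<open>k div s\<close>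
  only if \<open>s\<close> divides \<open>Suc k\<close>, and \<open>k div t\<close> only if
  \<open>t\<close> does. Both at once would force \<open>s * t\<close> to divide
  \<open>Suc k\<close>, impossible below \<open>s * t\<close>. So one side of \<open>eq\<close>
  stays put at every step, and the common value never changes.\<close>

lemma constant_of_coprime_blocks:
  fixes s t :: nat
  assumes "coprime s t" "s > 0"
    and eq: "\<And>k. k < s * t \<Longrightarrow> a (k div s) = b (k div t)"
    and "u < t"
  shows "a u = a 0"
proof -
  have "a (k div s) = a 0" if "k < s * t" for k
    using that
  proof (induction k)
    case (Suc k)
    have "\<not> s * t dvd Suc k" using Suc.prems by (auto dest: dvd_imp_le)
    then have "\<not> (s dvd Suc k \<and> t dvd Suc k)" using \<open>coprime s t\<close> by (auto intro: divides_mult)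
    then have "Suc k div s = k div s \<or> Suc k div t = k div t"
      by (auto simp: div_Suc dvd_eq_mod_eq_0)
    then have "a (Suc k div s) = a (k div s)"
      using eq[of k] eq[of "Suc k"] Suc.prems by auto
    then show ?case using Suc by simp
  qed simp
  \<comment> \<open>The position \<open>u * s\<close> starts the block numbered \<open>u\<close>,
    and \<open>u < t\<close> keeps it below \<open>s * t\<close>.\<close>
  from this[of "u * s"] show ?thesis using assms by (simp add: mult.commute)
qed

text \<open>Cut \<open>A\<close> into \<open>t\<close> by \<open>t\<close> blocks. Each block is a
  scalar matrix: comparison with the zeros of \<open>B \<otimes>\<^sub>K 1\<^sub>m t\<close> kills
  its off-diagonal entries, and \<open>constant_of_coprime_blocks\<close> makes its diagonal
  constant.\<close>

lemma kronecker_one_coprime_factor: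
  assumes eq: "A \<otimes>\<^sub>K 1\<^sub>m s = B \<otimes>\<^sub>K 1\<^sub>m t" and cop: "coprime s t" and s: "s > 0" and t: "t > 0"
  obtains C where "A = C \<otimes>\<^sub>K 1\<^sub>m t"
proof -
  have dims: "dim_row A * s = dim_row B * t" "dim_col A * s = dim_col B * t"
    using arg_cong[OF eq, of dim_row] arg_cong[OF eq, of dim_col] by simp_all
  have "t dvd dim_row A * s" "t dvd dim_col A * s" unfolding dims by simp_all
  then have "t dvd dim_row A" "t dvd dim_col A"
    using cop by (simp_all add: coprime_commute coprime_dvd_mult_left_iff)
  then obtain m n where m: "dim_row A = m * t" and n: "dim_col A = n * t"
    by (metis dvd_def mult.commute)
  \<comment> \<open>\<open>C\<close> collects the top left corners of the blocks, which are the
    candidate scalars.\<close>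
  define C where "C = mat m n (\<lambda>(p, q). A $$ (p * t, q * t))"
  have entry: "(if p mod s = q mod s then A $$ (p div s, q div s) else 0) =
      (if p mod t = q mod t then B $$ (p div t, q div t) else 0)"
    if "p < m * t * s" "q < n * t * s" for p q
    using index_kronecker_one[of p A s q] index_kronecker_one[of p B t q]
    unfolding eq using that unfolding m[symmetric] n[symmetric] by (simp add: dims)
  have "A = C \<otimes>\<^sub>K 1\<^sub>m t"
  proof (rule eq_matI)
    fix p q assume "p < dim_row (C \<otimes>\<^sub>K 1\<^sub>m t)" "q < dim_col (C \<otimes>\<^sub>K 1\<^sub>m t)"
    then have p: "p < m * t" and q: "q < n * t" by (simp_all add: C_def)
    then have p': "p div t < m" and q': "q div t < n" by (simp_all add: less_mult_imp_div_less)
    have "A $$ (p, q) = (if p mod t = q mod t then A $$ (p div t * t, q div t * t) else 0)"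
    proof (cases "p mod t = q mod t")
      case False
      \<comment> \<open>At \<open>(p * s, q * s)\<close> the left product shows the entry of
        \<open>A\<close> itself, both residues modulo \<open>s\<close> being 0. Since
        \<open>s\<close> is invertible modulo \<open>t\<close>, the right product vanishes
        there.\<close>
      then have "(p * s) mod t \<noteq> (q * s) mod t"
        using cong_mult_rcancel_nat[OF cop, of p q] by (simp add: cong_def)
      then show ?thesis using entry[of "p * s" "q * s"] p q s False by simp
    next
      case True
      \<comment> \<open>Both functions walk down diagonals: \<open>a\<close> in the \<open>t\<close>
        by \<open>t\<close> block of \<open>A\<close> around \<open>(p, q)\<close>, \<open>b\<close>
        in the \<open>s\<close> by \<open>s\<close> block of \<open>B\<close> with the same block
        indices. Either block expands to the same \<open>s * t\<close> by \<open>s * t\<close> block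
        of the common product, where \<open>k\<close> below counts diagonal positions.\<close>
      define a where "a u = A $$ (p div t * t + u, q div t * t + u)" for u
      define b where "b u = B $$ (p div t * s + u, q div t * s + u)" for u
      have "a (p mod t) = a 0"
      proof (rule constant_of_coprime_blocks[OF cop s])
        fix k assume k: "k < s * t"
        have bound: "x * (s * t) + k < y * t * s" if "x < y" for x y
        proof -
          have "x * (s * t) + k < Suc x * (s * t)" using k by simp
          also have "\<dots> \<le> y * (s * t)" using that by (intro mult_right_mono) auto
          finally show ?thesis by (simp add: ac_simps)
        qed
        have div_s: "(x * (s * t) + k) div s = x * t + k div s"
          and div_t: "(x * (s * t) + k) div t = x * s + k div t"
          and mod_s: "(x * (s * t) + k) mod s = k mod s"
          and mod_t: "(x * (s * t) + k) mod t = k mod t" for x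
        proof -
          have 1: "x * (s * t) + k = (x * t) * s + k" "x * (s * t) + k = (x * s) * t + k"
            by simp_all
          show "(x * (s * t) + k) div s = x * t + k div s"
            "(x * (s * t) + k) mod s = k mod s" unfolding 1(1) using s by simp_all
          show "(x * (s * t) + k) div t = x * s + k div t"
            "(x * (s * t) + k) mod t = k mod t" unfolding 1(2) using t by simp_all
        qed
        show "a (k div s) = b (k div t)"
          using entry[OF bound[OF p'] bound[OF q']]
          unfolding div_s div_t mod_s mod_t a_def b_def by simp
      qed (use t in simp)
      moreover have "a (p mod t) = A $$ (p, q)"
        using True unfolding a_def by (metis div_mult_mod_eq)
      ultimately show ?thesis using True by (simp add: a_def)
    qed
    then show "A $$ (p, q) = (C \<otimes>\<^sub>K 1\<^sub>m t) $$ (p, q)"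
      using p q p' q' by (simp add: index_kronecker_one C_def)
  qed (simp_all add: C_def m n)
  then show thesis by (rule that)
qed

lemma mat_class_irreducible:
  assumes "irreducible_mat A"
  shows "mat_class A = {A \<otimes>\<^sub>K 1\<^sub>m j | j. j \<ge> 1}"
proof (intro equalityI subsetI)
  fix B assume "B \<in> mat_class A"
  then obtain s t where s: "s > 0" and t: "t > 0" and eq: "A \<otimes>\<^sub>K 1\<^sub>m s = B \<otimes>\<^sub>K 1\<^sub>m t"
    by (auto simp: mat_class_def mat_equiv_def)
  define g where "g = gcd s t"
  define s' where "s' = s div g"
  define t' where "t' = t div g"
  have g: "g > 0" and s': "s = s' * g" and t': "t = t' * g"
    using s by (simp_all add: g_def s'_def t'_def)
  have pos: "s' > 0" "t' > 0"
    using s t s' t' by (auto intro: gr0I)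
  have cop: "coprime s' t'"
    unfolding s'_def t'_def g_def using s by (intro div_gcd_coprime) simp
  have "A \<otimes>\<^sub>K 1\<^sub>m s' \<otimes>\<^sub>K 1\<^sub>m g = B \<otimes>\<^sub>K 1\<^sub>m t' \<otimes>\<^sub>K 1\<^sub>m g"
    using eq s' t' by (simp add: kronecker_one_one)
  then have eq': "A \<otimes>\<^sub>K 1\<^sub>m s' = B \<otimes>\<^sub>K 1\<^sub>m t'"
    using g by (rule kronecker_one_cancel)
  then obtain C where "A = C \<otimes>\<^sub>K 1\<^sub>m t'"
    using kronecker_one_coprime_factor cop pos by blast
  then have "t' = 1" using assms pos(2) unfolding irreducible_mat_def
    by (metis One_nat_def Suc_1 Suc_leI le_neq_implies_less)
  then show "B \<in> {A \<otimes>\<^sub>K 1\<^sub>m j | j. j \<ge> 1}"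
    using eq' pos(1) by (auto intro!: exI[of _ s'])
next
  fix B assume "B \<in> {A \<otimes>\<^sub>K 1\<^sub>m j | j. j \<ge> 1}"
  then obtain j where "j \<ge> 1" "B = A \<otimes>\<^sub>K 1\<^sub>m j" by auto
  then have "A \<otimes>\<^sub>K 1\<^sub>m j = B \<otimes>\<^sub>K 1\<^sub>m 1" "j > 0" by simp_all
  then show "B \<in> mat_class A"
    unfolding mat_class_def mat_equiv_def by (blast intro: zero_less_one)
qed

lemma mat_prec_kronecker_one:
  assumes "dim_row A > 0" "k > 0"
  shows "mat_prec (A \<otimes>\<^sub>K 1\<^sub>m j) (A \<otimes>\<^sub>K 1\<^sub>m k) \<longleftrightarrow> j dvd k"
  unfolding mat_prec_def kronecker_one_one kronecker_one_inject[OF assms(1)]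
  using assms(2) by (auto elim!: dvdE)

section \<open>The lattices\<close>

text \<open>A common frame for the class and for the family of spaces. \<open>R_iff\<close> makes
  \<open>h\<close> injective on positive integers: \<open>h j = h k\<close> yields
  \<open>j dvd k\<close> and \<open>k dvd j\<close>.\<close>

locale divisibility_gorder =
  fixes h :: "nat \<Rightarrow> 'b" and R :: "'b \<Rightarrow> 'b \<Rightarrow> bool"
  assumes R_iff: "j > 0 \<Longrightarrow> k > 0 \<Longrightarrow> R (h j) (h k) \<longleftrightarrow> j dvd k"
begin

definition L :: "'b gorder" where
  "L = \<lparr>carrier = {h k | k. k > 0}, eq = (=), le = R\<rparr>"

lemma h_closed [simp]: "j > 0 \<Longrightarrow> h j \<in> carrier L"
  by (auto simp: L_def)

lemma least_lcm:
  assumes "j > 0" "k > 0"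
  shows "least L (h (lcm j k)) (Upper L {h j, h k})"
proof (rule least_UpperI)
  fix y assume y: "y \<in> Upper L {h j, h k}"
  have "R (h j) y" "R (h k) y" "y \<in> carrier L"
    using Upper_memD[OF y, of "h j"] Upper_memD[OF y, of "h k"] assms h_closed by (simp_all add: L_def)
  then show "h (lcm j k) \<sqsubseteq>\<^bsub>L\<^esub> y"
    using assms by (auto simp: L_def R_iff lcm_pos_nat)
qed (use assms in \<open>auto simp: L_def R_iff lcm_pos_nat\<close>)

lemma greatest_gcd:
  assumes "j > 0" "k > 0"
  shows "greatest L (h (gcd j k)) (Lower L {h j, h k})"
proof (rule greatest_LowerI)
  fix y assume y: "y \<in> Lower L {h j, h k}"
  have "R y (h j)" "R y (h k)" "y \<in> carrier L"
    using Lower_memD[OF y, of "h j"] Lower_memD[OF y, of "h k"] assms h_closed by (simp_all add: L_def)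
  then show "y \<sqsubseteq>\<^bsub>L\<^esub> h (gcd j k)"
    using assms by (auto simp: L_def R_iff)
qed (use assms in \<open>auto simp: L_def R_iff\<close>)

sublocale lattice L
proof
  show "\<exists>s. least L s (Upper L {x, y})" if "x \<in> carrier L" "y \<in> carrier L" for x y
    using that least_lcm by (auto simp: L_def)
  show "\<exists>s. greatest L s (Lower L {x, y})" if "x \<in> carrier L" "y \<in> carrier L" for x y
    using that greatest_gcd by (auto simp: L_def)
qed (auto simp: L_def R_iff dest: dvd_antisym dvd_trans)

lemma join_h: "j > 0 \<Longrightarrow> k > 0 \<Longrightarrow> h j \<squnion>\<^bsub>L\<^esub> h k = h (lcm j k)"
  by (rule joinI) (auto intro: least_unique least_lcm)

lemma meet_h: "j > 0 \<Longrightarrow> k > 0 \<Longrightarrow> h j \<sqinter>\<^bsub>L\<^esub> h k = h (gcd j k)"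
  by (rule meetI) (auto intro: greatest_unique greatest_gcd)

end

text \<open>On both sides joins and meets are \<open>lcm\<close> and \<open>gcd\<close> of indices,
  and multiplication by \<open>i\<close> distributes over both. Every carrier element is some
  \<open>h j\<close> with \<open>j > 0\<close>, so \<open>f\<close> matters only there.\<close>

lemma lattice_homomorphism_mult:
  assumes "divisibility_gorder h R" "divisibility_gorder h' R'" "i > 0"
    and f: "\<And>j. j > 0 \<Longrightarrow> f (h j) = h' (i * j)"
  shows "lattice_homomorphism (divisibility_gorder.L h R) (divisibility_gorder.L h' R') f"
proof -
  interpret X: divisibility_gorder h R by fact
  interpret Y: divisibility_gorder h' R' by fact
  have "f (x \<squnion>\<^bsub>X.L\<^esub> y) = f x \<squnion>\<^bsub>Y.L\<^esub> f y \<and> f (x \<sqinter>\<^bsub>X.L\<^esub> y) = f x \<sqinter>\<^bsub>Y.L\<^esub> f y"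
    if "x \<in> carrier X.L" "y \<in> carrier X.L" for x y
  proof -
    have "x \<in> {h j | j. j > 0}" "y \<in> {h k | k. k > 0}"
      using that by (simp_all add: X.L_def)
    then obtain j k where "x = h j" "y = h k" "j > 0" "k > 0" by blast
    then show ?thesis
      using \<open>i > 0\<close>
      by (simp add: X.join_h X.meet_h Y.join_h Y.meet_h f lcm_pos_nat lcm_mult_left gcd_mult_left)
  qed
  moreover have "f \<in> carrier X.L \<rightarrow> carrier Y.L"
  proof
    fix x assume "x \<in> carrier X.L"
    then obtain j where "x = h j" "j > 0" by (auto simp: X.L_def)
    then show "f x \<in> carrier Y.L" using f \<open>i > 0\<close> by simp
  qed
  ultimately show ?thesis
    by (simp add: lattice_homomorphism_def join_pres_def meet_pres_def X.lattice_axioms Y.lattice_axioms)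
qed

text \<open>Here \<open>y\<close> and \<open>x\<close> are the numerator and denominator of \<mu>.
  With \<mu> and the denominator positive, so is \<open>y\<close>; hence the row count determines
  \<open>k\<close>.\<close>

lemma mat_space_dims:
  assumes "\<mu> > 0"
  obtains y x where "y > 0" "\<And>k. (mat_space \<mu> k :: 'a mat set) = carrier_mat (k * y) (k * x)"
proof -
  obtain a b where ab: "quotient_of \<mu> = (a, b)" by (cases "quotient_of \<mu>")
  then have "\<mu> = of_int a / of_int b" "b > 0" by (auto intro: quotient_of_div quotient_of_denom_pos)
  then have "a > 0" using assms by (simp add: zero_less_divide_iff)
  then show thesis using ab by (intro that[of "nat a" "nat b"]) (simp_all add: mat_space_def)
qed

lemma mat_space_inject:
  assumes "\<mu> > 0"
  shows "(mat_space \<mu> j :: 'a::zero mat set) = mat_space \<mu> k \<longleftrightarrow> j = k"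
proof
  assume eq: "(mat_space \<mu> j :: 'a mat set) = mat_space \<mu> k"
  obtain y x where y: "y > 0" and M: "\<And>k. (mat_space \<mu> k :: 'a mat set) = carrier_mat (k * y) (k * x)"
    using mat_space_dims[OF assms] by blast
  \<comment> \<open>The zero matrix witnesses that the space is nonempty, so its row count can be
    compared in both descriptions.\<close>
  have "(0\<^sub>m (j * y) (j * x) :: 'a mat) \<in> mat_space \<mu> k"
    unfolding eq[symmetric] unfolding M by simp
  then have "dim_row (0\<^sub>m (j * y) (j * x) :: 'a mat) = k * y"
    unfolding M by (rule carrier_matD)
  then show "j = k" using y by simp
qed simp

theorem proposition36:
  fixes \<mu> :: rat and i :: nat and A :: "'a::field_char_0 mat"
  assumes "\<mu> > 0" and "i \<ge> 1" and "A \<in> mat_space \<mu> i" and "irreducible_mat A"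
  shows "mat_class A = {A \<otimes>\<^sub>K 1\<^sub>m j | j. j \<ge> 1} \<and>
    (\<exists>!\<phi>. \<phi> \<in> mat_class A \<rightarrow>\<^sub>E carrier (space_lattice \<mu> :: 'a mat set gorder) \<and>
          (\<forall>j\<ge>1. \<phi> (A \<otimes>\<^sub>K 1\<^sub>m j) = mat_space \<mu> (i * j))) \<and>
    (\<forall>\<phi>. (\<forall>j\<ge>1. \<phi> (A \<otimes>\<^sub>K 1\<^sub>m j) = mat_space \<mu> (i * j)) \<longrightarrow>
         lattice_homomorphism (class_lattice A) (space_lattice \<mu> :: 'a mat set gorder) \<phi>)"
proof -
  note cls = mat_class_irreducible[OF assms(4)]
  obtain y x where "y > 0" "\<And>k. (mat_space \<mu> k :: 'a mat set) = carrier_mat (k * y) (k * x)"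
    using mat_space_dims[OF assms(1)] by blast
  \<comment> \<open>\<open>A\<close> has \<open>i * y\<close> rows. A positive row count makes
    \<open>j\<close> recoverable from \<open>A \<otimes>\<^sub>K 1\<^sub>m j\<close>.\<close>
  then have A: "dim_row A > 0" using assms(2,3) by auto
  have X: "divisibility_gorder (\<lambda>j. A \<otimes>\<^sub>K 1\<^sub>m j) mat_prec"
    by unfold_locales (simp add: A mat_prec_kronecker_one)
  have Y: "divisibility_gorder (mat_space \<mu> :: nat \<Rightarrow> 'a mat set) (space_le \<mu>)"
    by unfold_locales (auto simp: space_le_def mat_space_inject[OF assms(1)])
  have XL: "class_lattice A = divisibility_gorder.L (\<lambda>j. A \<otimes>\<^sub>K 1\<^sub>m j) mat_prec"
    by (simp add: class_lattice_def cls divisibility_gorder.L_def[OF X] Suc_le_eq)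
  have YL: "(space_lattice \<mu> :: 'a mat set gorder) = divisibility_gorder.L (mat_space \<mu>) (space_le \<mu>)"
    by (simp add: space_lattice_def divisibility_gorder.L_def[OF Y])
  have "\<exists>!\<phi>. \<phi> \<in> mat_class A \<rightarrow>\<^sub>E carrier (space_lattice \<mu> :: 'a mat set gorder) \<and>
          (\<forall>j\<ge>1. \<phi> (A \<otimes>\<^sub>K 1\<^sub>m j) = mat_space \<mu> (i * j))"
  proof (rule ex_ex1I)
    \<comment> \<open>The description picks the unique index of \<open>B\<close> in the class; off
      the class the restricted function is \<open>undefined\<close>, as
      \<open>\<rightarrow>\<^sub>E\<close> demands.\<close>
    define \<phi> :: "'a mat \<Rightarrow> 'a mat set"
      where "\<phi> = (\<lambda>B\<in>mat_class A. mat_space \<mu> (i * (THE j. B = A \<otimes>\<^sub>K 1\<^sub>m j)))"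
    have \<phi>: "\<phi> (A \<otimes>\<^sub>K 1\<^sub>m j) = mat_space \<mu> (i * j)" if "j \<ge> 1" for j
      using that A by (auto simp: \<phi>_def cls kronecker_one_inject)
    moreover have "\<phi> \<in> mat_class A \<rightarrow>\<^sub>E carrier (space_lattice \<mu> :: 'a mat set gorder)"
    proof (rule PiE_I)
      fix B assume "B \<in> mat_class A"
      then obtain j where "j \<ge> 1" "B = A \<otimes>\<^sub>K 1\<^sub>m j" by (auto simp: cls)
      then show "\<phi> B \<in> carrier (space_lattice \<mu>)"
        using \<phi> assms(2) by (auto simp: space_lattice_def intro!: exI[of _ "i * j"])
    qed (simp add: \<phi>_def)
    ultimately show "\<exists>\<phi>. \<phi> \<in> mat_class A \<rightarrow>\<^sub>E carrier (space_lattice \<mu> :: 'a mat set gorder) \<and>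
        (\<forall>j\<ge>1. \<phi> (A \<otimes>\<^sub>K 1\<^sub>m j) = mat_space \<mu> (i * j))" by (intro exI[of _ \<phi>] conjI allI impI)
  next
    fix \<phi> \<psi>
    assume 1: "\<phi> \<in> mat_class A \<rightarrow>\<^sub>E carrier (space_lattice \<mu> :: 'a mat set gorder) \<and>
        (\<forall>j\<ge>1. \<phi> (A \<otimes>\<^sub>K 1\<^sub>m j) = mat_space \<mu> (i * j))"
      and 2: "\<psi> \<in> mat_class A \<rightarrow>\<^sub>E carrier (space_lattice \<mu> :: 'a mat set gorder) \<and>
        (\<forall>j\<ge>1. \<psi> (A \<otimes>\<^sub>K 1\<^sub>m j) = mat_space \<mu> (i * j))"
    have "\<phi> B = \<psi> B" if B: "B \<in> mat_class A" for B
    proof -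
      obtain j where "j \<ge> 1" "B = A \<otimes>\<^sub>K 1\<^sub>m j" using B by (auto simp: cls)
      then show ?thesis using 1[THEN conjunct2, rule_format] 2[THEN conjunct2, rule_format] by simp
    qed
    then show "\<phi> = \<psi>" by (rule PiE_ext[OF 1[THEN conjunct1] 2[THEN conjunct1]])
  qed
  moreover have "lattice_homomorphism (class_lattice A) (space_lattice \<mu> :: 'a mat set gorder) \<phi>"
    if "\<forall>j\<ge>1. \<phi> (A \<otimes>\<^sub>K 1\<^sub>m j) = mat_space \<mu> (i * j)" for \<phi>
    unfolding XL YL using that assms(2) by (intro lattice_homomorphism_mult[OF X Y, of i]) simp_all
  ultimately show ?thesis using cls by (intro conjI allI impI)
qed

end
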